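(* There exists a sequence of positive, increasing numbers $(\lambda_n)_{n\ge 0}$ with $\lambda_n \uparrow +\infty$ and $\sum_n \frac{1}{\lambda_n} = +\infty$, such that whenever $S$ is a non-zero distribution on $\mathbb{T}$ with \[ \sum_{n\in\mathbb{Z}} |\widehat{S}(n)|^2 \lambda_{|n|} < \infty , \] then $\operatorname{supp}(S)=\mathbb{T}$.
   Context: $\mathbb{T}$ is the unit circle in $\mathbb{C}$. For a distribution $S$ on $\mathbb{T}$ (a continuous linear functional on $C^\infty(\mathbb{T})$), $\widehat{S}(n)=S(\overline{\zeta}^{\,n})$, $n\in\mathbb{Z}$, are its Fourier coefficients, and $\operatorname{supp}(S)$ is its closed support, the complement of the largest open subset of $\mathbb{T}$ on which $S$ vanishes. *)

theory Defs
  imports "HOL-Analysis.Analysis"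
begin

abbreviation unit_circle :: "complex set" where
  "unit_circle \<equiv> sphere 0 1"

text \<open>The \<open>k\<close>-th derivative of \<open>f\<close> along the circle, that is, of \<open>t \<mapsto> f (e\<^sup>i\<^sup>t)\<close> as a function of
  the angle.\<close>

definition circle_deriv :: "nat \<Rightarrow> (complex \<Rightarrow> complex) \<Rightarrow> real \<Rightarrow> complex" where
  "circle_deriv k f = ((\<lambda>g t. vector_derivative g (at t)) ^^ k) (\<lambda>t. f (cis t))"

text \<open>A function on the circle is represented by any extension of it to the complex plane; only the
  values on the circle matter. The topology below does not separate two extensions of the same
  function, so a continuous linear functional takes the same value on them, and the continuous
  linear functionals are exactly those on smooth functions on the circle.\<close>

definition smooth_circle :: "(complex \<Rightarrow> complex) set" where
  "smooth_circle = {f. \<forall>k t. circle_deriv k f differentiable (at t)}"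

text \<open>The usual Frechet topology: uniform convergence of every derivative.\<close>

definition smooth_circle_open :: "(complex \<Rightarrow> complex) set \<Rightarrow> bool" where
  "smooth_circle_open U \<longleftrightarrow> U \<subseteq> smooth_circle \<and>
     (\<forall>f\<in>U. \<exists>N. \<exists>\<epsilon>>0. \<forall>g\<in>smooth_circle.
        (\<forall>k\<le>N. \<forall>t. cmod (circle_deriv k g t - circle_deriv k f t) < \<epsilon>) \<longrightarrow> g \<in> U)"

definition smooth_circle_topology :: "(complex \<Rightarrow> complex) topology" where
  "smooth_circle_topology = topology smooth_circle_open"

lemma istopology_smooth_circle_open: "istopology smooth_circle_open"
  unfolding istopology_def
proof (intro conjI allI impI)
  fix U V assume U: "smooth_circle_open U" and V: "smooth_circle_open V"
  show "smooth_circle_open (U \<inter> V)"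
    unfolding smooth_circle_open_def
  proof (intro conjI ballI)
    show "U \<inter> V \<subseteq> smooth_circle" using U unfolding smooth_circle_open_def by blast
    fix f assume f: "f \<in> U \<inter> V"
    obtain N \<epsilon> where 1: "\<epsilon> > 0" "\<And>g. g \<in> smooth_circle \<Longrightarrow>
        (\<forall>k\<le>N. \<forall>t. cmod (circle_deriv k g t - circle_deriv k f t) < \<epsilon>) \<Longrightarrow> g \<in> U"
      using U f unfolding smooth_circle_open_def by blast
    obtain M \<delta> where 2: "\<delta> > 0" "\<And>g. g \<in> smooth_circle \<Longrightarrow>
        (\<forall>k\<le>M. \<forall>t. cmod (circle_deriv k g t - circle_deriv k f t) < \<delta>) \<Longrightarrow> g \<in> V"
      using V f unfolding smooth_circle_open_def by blast
    show "\<exists>N. \<exists>\<epsilon>>0. \<forall>g\<in>smooth_circle.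
        (\<forall>k\<le>N. \<forall>t. cmod (circle_deriv k g t - circle_deriv k f t) < \<epsilon>) \<longrightarrow> g \<in> U \<inter> V"
      by (rule exI[of _ "max N M"], rule exI[of _ "min \<epsilon> \<delta>"]) (use 1 2 in auto)
  qed
next
  fix K assume K: "\<forall>U\<in>K. smooth_circle_open U"
  show "smooth_circle_open (\<Union>K)"
    unfolding smooth_circle_open_def
  proof (intro conjI ballI)
    show "\<Union>K \<subseteq> smooth_circle" using K unfolding smooth_circle_open_def by blast
    fix f assume "f \<in> \<Union>K"
    then obtain U where "U \<in> K" "f \<in> U" by blast
    then show "\<exists>N. \<exists>\<epsilon>>0. \<forall>g\<in>smooth_circle.
        (\<forall>k\<le>N. \<forall>t. cmod (circle_deriv k g t - circle_deriv k f t) < \<epsilon>) \<longrightarrow> g \<in> \<Union>K"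
      using K unfolding smooth_circle_open_def by (meson UnionI)
  qed
qed

lemma openin_smooth_circle_topology:
  "openin smooth_circle_topology U \<longleftrightarrow> smooth_circle_open U"
  by (simp add: smooth_circle_topology_def topology_inverse' istopology_smooth_circle_open)

lemma topspace_smooth_circle_topology: "topspace smooth_circle_topology = smooth_circle"
proof -
  have "smooth_circle_open smooth_circle"
    unfolding smooth_circle_open_def using zero_less_one by blast
  then show ?thesis
    unfolding topspace_def openin_smooth_circle_topology
    by (auto simp: smooth_circle_open_def)
qed

text \<open>Only the values on smooth functions are constrained.\<close>

definition circle_distribution :: "((complex \<Rightarrow> complex) \<Rightarrow> complex) \<Rightarrow> bool" where
  "circle_distribution S \<longleftrightarrow>
     (\<forall>f\<in>smooth_circle. \<forall>g\<in>smooth_circle. S (\<lambda>z. f z + g z) = S f + S g) \<and>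
     (\<forall>c. \<forall>f\<in>smooth_circle. S (\<lambda>z. c * f z) = c * S f) \<and>
     continuous_map smooth_circle_topology euclidean S"

definition fourier_coeff :: "((complex \<Rightarrow> complex) \<Rightarrow> complex) \<Rightarrow> int \<Rightarrow> complex" where
  "fourier_coeff S n = S (\<lambda>z. cnj z powi n)"

definition vanishes_on :: "((complex \<Rightarrow> complex) \<Rightarrow> complex) \<Rightarrow> complex set \<Rightarrow> bool" where
  "vanishes_on S U \<longleftrightarrow>
     (\<forall>f\<in>smooth_circle. closure {z \<in> unit_circle. f z \<noteq> 0} \<subseteq> U \<longrightarrow> S f = 0)"

text \<open>The largest relatively open set on which a distribution vanishes is the union of all such
  sets.\<close>

definition dist_support :: "((complex \<Rightarrow> complex) \<Rightarrow> complex) \<Rightarrow> complex set" where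
  "dist_support S =
     unit_circle - \<Union>{U. openin (top_of_set unit_circle) U \<and> vanishes_on S U}"

end

theory Submission
  imports Defs "HOL-Computational_Algebra.Polynomial"
begin

text \<open>
  If the weight exceeds a huge number beyond \<open>N\<close>, then a distribution of finite weighted norm is
  almost a trigonometric polynomial of degree \<open>N\<close>, and such a polynomial cannot be small on an arc.
  Dually: for every arc \<open>V\<close> and \<open>\<bar>m\<bar> \<le> N\<close> there is a smooth \<open>\<psi>\<close> supported in \<open>V\<close> whose
  coefficients of index at most \<open>N\<close> vanish, except for the \<open>m\<close>-th, which is 1. If \<open>S\<close> vanishes on
  \<open>V\<close>, then \<open>0 = S \<psi>\<close> bounds the coefficient of \<open>S\<close> of index \<open>-m\<close> by the coefficients of \<open>S\<close> beyond
  \<open>N\<close> times a constant \<open>K N\<close>, which can be taken uniform over finitely many arcs. The weight therefore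
  jumps above \<open>(N * K N)\<^sup>2\<close> at infinitely many \<open>N\<close> and stays nearly constant between the jumps, long
  enough for \<open>\<Sum> 1 / lam n\<close> to diverge. Running through a countable basis of arcs, all coefficients of
  \<open>S\<close> vanish, hence \<open>S = 0\<close>.
\<close>

subsection \<open>Calculus on the circle\<close>

lemma circle_deriv_0 [simp]: "circle_deriv 0 f t = f (cis t)"
  by (simp add: circle_deriv_def)

lemma circle_deriv_has_vector_derivative:
  assumes "f \<in> smooth_circle"
  shows "(circle_deriv k f has_vector_derivative circle_deriv (Suc k) f t) (at t)"
proof -
  have "circle_deriv k f differentiable (at t)"
    using assms by (simp add: smooth_circle_def)
  then show ?thesis
    by (simp add: circle_deriv_def vector_derivative_works)
qed

text \<open>Guessing all derivatives at once: a sequence \<open>d\<close> in which each member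
  differentiates to the next settles both smoothness and the value of every derivative, by induction
  on \<open>k\<close>.\<close>

lemma circle_deriv_unique:
  assumes "\<And>t. d 0 t = f (cis t)"
    and "\<And>k t. (d k has_vector_derivative d (Suc k) t) (at t)"
  shows "f \<in> smooth_circle" and "circle_deriv k f = d k"
proof -
  have *: "circle_deriv k f = d k" for k
  proof (induction k)
    case 0
    then show ?case using assms(1) by (auto simp: fun_eq_iff)
  next
    case (Suc k)
    have "circle_deriv (Suc k) f = (\<lambda>t. vector_derivative (circle_deriv k f) (at t))"
      by (simp add: circle_deriv_def)
    also have "\<dots> = d (Suc k)"
      using assms(2) Suc vector_derivative_at by fastforce
    finally show ?case .
  qed
  then show "circle_deriv k f = d k" .
  show "f \<in> smooth_circle"
    using assms(2) by (auto simp: smooth_circle_def * intro: differentiableI_vector)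
qed

text \<open>Serves functions whose derivatives have no convenient closed form: if differentiation
  does not lead out of \<open>C\<close>, then by induction all derivatives exist and stay in
  \<open>C\<close>.\<close>

lemma smooth_circle_coinduct:
  assumes "(\<lambda>t. f (cis t)) \<in> C"
    and "\<And>g. g \<in> C \<Longrightarrow> \<exists>g'\<in>C. \<forall>t. (g has_vector_derivative g' t) (at t)"
  shows "f \<in> smooth_circle"
proof -
  have *: "circle_deriv k f \<in> C" for k
  proof (induction k)
    case 0
    then show ?case using assms(1) by (simp add: circle_deriv_def)
  next
    case (Suc k)
    then obtain g' where "g' \<in> C" "\<forall>t. (circle_deriv k f has_vector_derivative g' t) (at t)"
      using assms(2) by blast
    moreover from this have "circle_deriv (Suc k) f = g'"
      by (auto simp: circle_deriv_def fun_eq_iff intro: vector_derivative_at)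
    ultimately show ?case by simp
  qed
  show ?thesis
    unfolding smooth_circle_def using assms(2)[OF *] differentiableI_vector by blast
qed

text \<open>Translation by a period fixes \<open>t \<mapsto> f (cis t)\<close> and commutes with
  differentiation. Hence every derivative in the angle descends to a function on the circle.\<close>

lemma circle_deriv_periodic:
  assumes "f \<in> smooth_circle" "cis s = cis t"
  shows "circle_deriv k f s = circle_deriv k f t"
proof -
  have *: "circle_deriv k f (t + c) = circle_deriv k f t" if "cis c = 1" for c t
  proof (induction k arbitrary: t)
    case 0
    then show ?case using that by (simp flip: cis_mult)
  next
    case (Suc k)
    have "((circle_deriv k f \<circ> (\<lambda>t. t + c)) has_vector_derivative
        1 *\<^sub>R circle_deriv (Suc k) f (t + c)) (at t)"
      by (rule vector_diff_chain_at)
        (auto intro!: derivative_eq_intros circle_deriv_has_vector_derivative assms)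
    moreover have "circle_deriv k f \<circ> (\<lambda>t. t + c) = circle_deriv k f"
      using Suc by auto
    ultimately show ?case
      using vector_derivative_unique_at circle_deriv_has_vector_derivative[OF assms(1), of k t]
      by fastforce
  qed
  have "cis (s - t) = 1"
    using assms(2) by (simp flip: cis_divide)
  from *[OF this, of t] show ?thesis by simp
qed

lemma cis_Arg_unit: "cmod z = 1 \<Longrightarrow> cis (Arg z) = z"
  by (cases "z = 0") (simp_all add: cis_Arg sgn_eq)

lemma cis_Arg2pi_unit: "cmod z = 1 \<Longrightarrow> cis (Arg2pi z) = z"
  by (metis complex_norm_eq_1_exp cis_conv_exp)

lemma circle_deriv_Arg_cis:
  "f \<in> smooth_circle \<Longrightarrow> circle_deriv k f (Arg (cis t)) = circle_deriv k f t"
  by (rule circle_deriv_periodic) (simp_all add: cis_Arg_unit)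

lemma circle_deriv_Arg2pi_cis:
  "f \<in> smooth_circle \<Longrightarrow> circle_deriv k f (Arg2pi (cis t)) = circle_deriv k f t"
  by (rule circle_deriv_periodic) (simp_all add: cis_Arg2pi_unit)

lemma continuous_on_circle_deriv:
  "f \<in> smooth_circle \<Longrightarrow> continuous_on A (circle_deriv k f)"
  by (meson circle_deriv_has_vector_derivative continuous_at_imp_continuous_on
      has_vector_derivative_continuous)

lemma smooth_circle_zero: "(\<lambda>z. 0) \<in> smooth_circle"
  by (rule circle_deriv_unique(1)[where d = "\<lambda>k t. 0"]) auto

lemma smooth_circle_cmult:
  assumes "f \<in> smooth_circle"
  shows "(\<lambda>z. c * f z) \<in> smooth_circle"
  by (rule circle_deriv_unique(1)[where d = "\<lambda>k t. c * circle_deriv k f t"])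
    (use assms in \<open>auto intro!: derivative_eq_intros circle_deriv_has_vector_derivative\<close>)

lemma
  assumes "finite A" "\<And>i. i \<in> A \<Longrightarrow> f i \<in> smooth_circle"
  shows smooth_circle_sum: "(\<lambda>z. \<Sum>i\<in>A. c i * f i z) \<in> smooth_circle"
    and circle_deriv_sum: "circle_deriv k (\<lambda>z. \<Sum>i\<in>A. c i * f i z) =
      (\<lambda>t. \<Sum>i\<in>A. c i * circle_deriv k (f i) t)"
  by (rule circle_deriv_unique[where d = "\<lambda>k t. \<Sum>i\<in>A. c i * circle_deriv k (f i) t"],
      use assms in \<open>auto intro!: has_vector_derivative_sum derivative_eq_intros
        circle_deriv_has_vector_derivative\<close>)+

lemma cis_has_vector_derivative:
  "((\<lambda>t. cis (a * t)) has_vector_derivative (\<i> * of_real a * cis (a * t))) (at t)"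
proof -
  have "((\<lambda>t. cis (a * t)) has_derivative (\<lambda>x. (a * x) *\<^sub>R (\<i> * cis (a * t)))) (at t)"
    by (rule has_derivative_cis) (auto intro!: derivative_eq_intros)
  then show ?thesis
    by (simp add: has_vector_derivative_def scaleR_conv_of_real mult_ac)
qed

lemma cnj_cis_powi: "cnj (cis t) powi n = cis (- of_int n * t)"
  by (simp add: cis_cnj cis_power_int)

lemma
  shows smooth_circle_cnj_powi: "(\<lambda>z. cnj z powi n) \<in> smooth_circle"
    and circle_deriv_cnj_powi: "circle_deriv k (\<lambda>z. cnj z powi n) =
      (\<lambda>t. (- \<i> * of_int n) ^ k * cis (- of_int n * t))"
proof -
  let ?d = "\<lambda>k t. (- \<i> * of_int n) ^ k * cis (- of_int n * t)"
  have "(?d k has_vector_derivative ?d (Suc k) t) (at t)" for k t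
    using has_vector_derivative_mult_right[OF cis_has_vector_derivative, of "(- \<i> * of_int n) ^ k" "- of_int n" t]
    by (simp add: mult_ac)
  then show "(\<lambda>z. cnj z powi n) \<in> smooth_circle" "circle_deriv k (\<lambda>z. cnj z powi n) = ?d k"
    by (rule circle_deriv_unique[where d = ?d, rotated]; simp add: cnj_cis_powi)+
qed

text \<open>Compactness of one period; \<open>Arg\<close> moves an arbitrary angle into it.\<close>

lemma circle_deriv_bounded:
  assumes "f \<in> smooth_circle"
  obtains B where "B > 0" "\<And>t. cmod (circle_deriv k f t) \<le> B"
proof -
  have "compact (circle_deriv k f ` {-pi..pi})"
    by (intro compact_continuous_image continuous_on_circle_deriv assms compact_Icc)
  then obtain B where B: "B > 0" "\<And>t. t \<in> {-pi..pi} \<Longrightarrow> cmod (circle_deriv k f t) \<le> B"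
    using compact_imp_bounded bounded_pos by (metis imageI)
  have "cmod (circle_deriv k f t) \<le> B" for t
    using B(2)[of "Arg (cis t)"] Arg_bounded[of "cis t"] assms by (auto simp: circle_deriv_Arg_cis)
  then show ?thesis using B that by blast
qed

text \<open>\<open>Arg\<close> jumps at \<open>-1\<close>, but derivatives are periodic, so the branch \<open>Arg2pi\<close>, which jumps at \<open>1\<close>,
  gives the same function on the circle.\<close>

definition circle_fun :: "nat \<Rightarrow> (complex \<Rightarrow> complex) \<Rightarrow> complex \<Rightarrow> complex" where
  "circle_fun k f z = circle_deriv k f (Arg z)"

lemma continuous_on_circle_fun:
  assumes "f \<in> smooth_circle"
  shows "continuous_on unit_circle (circle_fun k f)"
proof -
  have cont: "isCont (circle_deriv k f) x" for x
    using circle_deriv_has_vector_derivative[OF assms] has_vector_derivative_continuous by blast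
  have "continuous (at z within unit_circle) (circle_fun k f)" if z: "z \<in> unit_circle" for z
  proof (cases "z \<in> \<real>\<^sub>\<le>\<^sub>0")
    case False
    have "isCont (circle_fun k f) z"
      unfolding circle_fun_def
      by (rule isCont_o2[OF continuous_at_Arg[OF False] cont])
    then show ?thesis by (rule continuous_at_imp_continuous_within)
  next
    case True
    then have "z \<notin> \<real>\<^sub>\<ge>\<^sub>0"
      using z by (auto simp: complex_nonneg_Reals_iff complex_nonpos_Reals_iff cmod_def)
    then have "isCont (\<lambda>z. circle_deriv k f (Arg2pi z)) z"
      by (rule isCont_o2[OF continuous_at_Arg2pi cont])
    then have "continuous (at z within unit_circle) (\<lambda>z. circle_deriv k f (Arg2pi z))"
      by (rule continuous_at_imp_continuous_within)
    moreover have "circle_deriv k f (Arg2pi w) = circle_fun k f w" if "w \<in> unit_circle" for w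
    proof -
      have w: "w = cis (Arg w)" using that by (simp add: cis_Arg_unit)
      show ?thesis
        unfolding circle_fun_def by (subst w) (simp add: circle_deriv_Arg2pi_cis assms)
    qed
    ultimately show ?thesis
      using z by (auto intro: continuous_transform_within[OF _ zero_less_one])
  qed
  then show ?thesis by (simp add: continuous_on_eq_continuous_within)
qed

subsection \<open>Fourier series of smooth functions\<close>

text \<open>The argument is a function of the angle rather than of a point of the circle, so that it
  applies directly to every \<open>circle_deriv k f\<close>.\<close>

definition circle_coeff :: "(real \<Rightarrow> complex) \<Rightarrow> int \<Rightarrow> complex" where
  "circle_coeff g n = integral {0..2 * pi} (\<lambda>t. g t * cis (- of_int n * t)) / of_real (2 * pi)"

lemma continuous_on_cis_mult [continuous_intros]: "continuous_on A (\<lambda>t. cis (a * t))"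
  by (simp add: cis_conv_exp continuous_intros)

lemma circle_coeff_add:
  assumes "continuous_on {0..2 * pi} f" "continuous_on {0..2 * pi} g"
  shows "circle_coeff (\<lambda>t. f t + g t) n = circle_coeff f n + circle_coeff g n"
proof -
  have "integral {0..2 * pi} (\<lambda>t. f t * cis (- of_int n * t) + g t * cis (- of_int n * t)) =
    integral {0..2 * pi} (\<lambda>t. f t * cis (- of_int n * t)) +
    integral {0..2 * pi} (\<lambda>t. g t * cis (- of_int n * t))"
    by (rule integral_add; intro integrable_continuous_real continuous_intros assms)
  then show ?thesis by (simp add: circle_coeff_def add_divide_distrib ring_distribs)
qed

lemma circle_coeff_cmult: "circle_coeff (\<lambda>t. c * f t) n = c * circle_coeff f n"
  by (simp add: circle_coeff_def mult.assoc)

lemma circle_coeff_diff: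
  assumes "continuous_on {0..2 * pi} f" "continuous_on {0..2 * pi} g"
  shows "circle_coeff (\<lambda>t. f t - g t) n = circle_coeff f n - circle_coeff g n"
  using circle_coeff_add[OF assms(1) continuous_on_mult_left[OF assms(2), of "-1"], of n]
    circle_coeff_cmult[of "-1" g n] by simp

lemma circle_coeff_cis_mult:
  "circle_coeff (\<lambda>t. cis (of_int m * t) * g t) n = circle_coeff g (n - m)"
proof -
  have "cis (of_int m * t) * g t * cis (- of_int n * t) = g t * cis (- of_int (n - m) * t)" for t
    by (simp add: cis_mult algebra_simps)
  then show ?thesis by (simp only: circle_coeff_def)
qed

lemma circle_coeff_0_1: "circle_coeff (\<lambda>t. 1) n = (if n = 0 then 1 else 0)"
proof (cases "n = 0")
  case False
  let ?F = "\<lambda>t. cis (- of_int n * t) / (\<i> * of_real (- of_int n))"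
  have "((\<lambda>t. cis (- of_int n * t)) has_integral ?F (2 * pi) - ?F 0) {0..2 * pi}"
  proof (rule fundamental_theorem_of_calculus)
    fix t
    show "(?F has_vector_derivative cis (- of_int n * t)) (at t within {0..2 * pi})"
      using has_vector_derivative_divide[OF cis_has_vector_derivative[of "- of_int n" t],
          of "\<i> * of_real (- of_int n)"] False
      by (auto intro: has_vector_derivative_at_within)
  qed simp
  moreover have "cis (- of_int n * (2 * pi)) = 1"
    using cis_multiple_2pi[of "- of_int n"] by (simp add: mult_ac)
  ultimately show ?thesis
    using False by (simp add: circle_coeff_def integral_unique)
qed (simp add: circle_coeff_def scaleR_conv_of_real)

lemma circle_coeff_cis: "circle_coeff (\<lambda>t. cis (of_int m * t)) n = (if n = m then 1 else 0)"
  using circle_coeff_cis_mult[of m "\<lambda>t. 1" n] by (simp add: circle_coeff_0_1)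

lemma circle_coeff_sum:
  assumes "finite A" "\<And>i. i \<in> A \<Longrightarrow> continuous_on {0..2 * pi} (g i)"
  shows "circle_coeff (\<lambda>t. \<Sum>i\<in>A. g i t) n = (\<Sum>i\<in>A. circle_coeff (g i) n)"
  using assms
  by (induction A rule: finite_induct)
    (auto simp: circle_coeff_add continuous_on_sum, simp add: circle_coeff_def)

lemma norm_circle_coeff_le:
  assumes "continuous_on {0..2 * pi} g" "\<And>t. cmod (g t) \<le> B"
  shows "cmod (circle_coeff g n) \<le> B"
proof -
  have "cmod (integral {0..2 * pi} (\<lambda>t. g t * cis (- of_int n * t))) \<le> B * (2 * pi - 0)"
    by (rule integral_bound) (auto simp: norm_mult assms intro!: continuous_intros)
  then show ?thesis by (simp add: circle_coeff_def norm_divide field_simps)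
qed

text \<open>Integration by parts over a full period, where the boundary terms cancel.\<close>

lemma circle_coeff_deriv:
  assumes "f \<in> smooth_circle"
  shows "circle_coeff (circle_deriv (Suc k) f) n = \<i> * of_int n * circle_coeff (circle_deriv k f) n"
proof -
  let ?e = "\<lambda>t. cis (- of_int n * t)"
  \<comment> \<open>The derivative of \<open>circle_deriv k f t * ?e t\<close> by the product
    rule.\<close>
  let ?h = "\<lambda>t. circle_deriv k f t * (- \<i> * of_int n * ?e t) + circle_deriv (Suc k) f t * ?e t"
  have "(?h has_integral circle_deriv k f (2 * pi) * ?e (2 * pi) - circle_deriv k f 0 * ?e 0)
      {0..2 * pi}"
  proof (rule fundamental_theorem_of_calculus)
    fix t
    have "((\<lambda>t. circle_deriv k f t * ?e t) has_vector_derivative ?h t) (at t)"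
      using has_vector_derivative_mult[OF circle_deriv_has_vector_derivative[OF assms]
        cis_has_vector_derivative[of "- of_int n" t]] by simp
    then show "((\<lambda>t. circle_deriv k f t * ?e t) has_vector_derivative ?h t) (at t within {0..2 * pi})"
      by (rule has_vector_derivative_at_within)
  qed simp
  moreover have "circle_deriv k f (2 * pi) = circle_deriv k f 0"
    by (rule circle_deriv_periodic) (use assms in auto)
  moreover have "?e (2 * pi) = 1"
    using cis_multiple_2pi[of "- of_int n"] by (simp add: mult_ac)
  ultimately have "(?h has_integral 0) {0..2 * pi}" by simp
  then have 0: "integral {0..2 * pi} ?h = 0" by (rule integral_unique)
  have "integral {0..2 * pi} ?h = - \<i> * of_int n * integral {0..2 * pi} (\<lambda>t. circle_deriv k f t * ?e t) +
      integral {0..2 * pi} (\<lambda>t. circle_deriv (Suc k) f t * ?e t)"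
  proof (subst integral_add)
    have "(\<lambda>t. circle_deriv k f t * (- \<i> * of_int n * ?e t)) =
        (\<lambda>t. - \<i> * of_int n * (circle_deriv k f t * ?e t))" by (auto simp: mult_ac)
    then show "integral {0..2 * pi} (\<lambda>t. circle_deriv k f t * (- \<i> * of_int n * ?e t)) +
      integral {0..2 * pi} (\<lambda>t. circle_deriv (Suc k) f t * ?e t) =
       - \<i> * of_int n * integral {0..2 * pi} (\<lambda>t. circle_deriv k f t * ?e t) +
      integral {0..2 * pi} (\<lambda>t. circle_deriv (Suc k) f t * ?e t)"
      by (simp only: integral_mult_right)
  qed (intro integrable_continuous_real continuous_intros continuous_on_circle_deriv assms)+
  with 0 show ?thesis by (simp add: circle_coeff_def add_eq_0_iff)
qed

lemma summable_on_inverse_squares_int: "(\<lambda>n::int. 1 / (of_int n)\<^sup>2 :: real) summable_on UNIV"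
proof -
  \<comment> \<open>The term at 0 is 1 / 0 = 0, so the sum may run over all integers.\<close>
  let ?f = "\<lambda>n::int. 1 / (of_int n)\<^sup>2 :: real"
  have nat: "(\<lambda>n::nat. 1 / (real n)\<^sup>2) summable_on UNIV"
    by (rule summable_nonneg_imp_summable_on)
      (use inverse_power_summable[of 2, where ?'a = real] in \<open>auto simp: field_simps\<close>)
  have "?f summable_on (range int)" "?f summable_on (range (\<lambda>n. - int n))"
    using nat by (subst summable_on_reindex; auto simp: inj_on_def o_def)+
  \<comment> \<open>Both ranges contain 0, so the overlap is removed before the disjoint
    union.\<close>
  then have "?f summable_on (range int \<union> (range (\<lambda>n. - int n) - range int))"
    by (intro summable_on_Un_disjoint) (auto intro: summable_on_subset_banach)
  moreover have "range int \<union> (range (\<lambda>n. - int n) - range int) = UNIV"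
    by (auto, metis int_cases2 rangeI)
  ultimately show ?thesis by simp
qed

text \<open>Differentiating twice more multiplies the coefficient by -n^2 and keeps it bounded, so
  the coefficients decay like 1 / n^2.\<close>

lemma circle_coeff_abs_summable:
  assumes "f \<in> smooth_circle"
  shows "(\<lambda>n. cmod (circle_coeff (circle_deriv k f) n)) summable_on UNIV"
proof -
  obtain B where B: "B > 0" "\<And>t. cmod (circle_deriv (Suc (Suc k)) f t) \<le> B"
    using circle_deriv_bounded[OF assms] by blast
  have "(\<lambda>n::int. B * (1 / (of_int n)\<^sup>2)) summable_on UNIV"
    by (intro summable_on_cmult_right summable_on_inverse_squares_int)
  \<comment> \<open>At index 0 the majorant is 1 / 0 = 0, so this index is split off for the
    comparison and put back as a finite set.\<close>
  then have "(\<lambda>n::int. B * (1 / (of_int n)\<^sup>2)) summable_on (UNIV - {0})"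
    by (rule summable_on_subset_banach) auto
  then have "(\<lambda>n. cmod (circle_coeff (circle_deriv k f) n)) summable_on (UNIV - {0})"
  proof (rule summable_on_comparison_test)
    fix n :: int assume n: "n \<in> UNIV - {0}"
    have "circle_coeff (circle_deriv (Suc (Suc k)) f) n = (\<i> * of_int n)\<^sup>2 * circle_coeff (circle_deriv k f) n"
      by (simp add: circle_coeff_deriv assms power2_eq_square)
    then have "(of_int n)\<^sup>2 * cmod (circle_coeff (circle_deriv k f) n) \<le> B"
      using norm_circle_coeff_le[OF continuous_on_circle_deriv[OF assms] B(2), of n]
      by (simp add: norm_mult norm_power)
    then show "cmod (circle_coeff (circle_deriv k f) n) \<le> B * (1 / (of_int n)\<^sup>2)"
      using n by (simp add: field_simps)
  qed auto
  then have "(\<lambda>n. cmod (circle_coeff (circle_deriv k f) n)) summable_on ((UNIV - {0}) \<union> {0})"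
    by (intro summable_on_Un_disjoint) auto
  then show ?thesis by simp
qed

section \<open>Uniqueness of Fourier coefficients of continuous functions\<close>

lemma continuous_on_mult_real_polynomial:
  fixes q :: "complex \<Rightarrow> real"
  assumes "real_polynomial_function q" "continuous_on A H"
  shows "continuous_on A (\<lambda>z. H z * complex_of_real (q z))"
proof (intro continuous_on_mult continuous_on_of_real)
  show "continuous_on A q"
    using assms(1) by (simp add: continuous_on_polymonial_function real_polynomial_function_eq)
qed fact

lemma continuous_on_circle_compose_cis:
  assumes "continuous_on unit_circle H"
  shows "continuous_on A (\<lambda>t. H (cis t))"
  by (rule continuous_on_compose2[OF assms]) (use continuous_on_cis_mult[of _ 1] in auto)

text \<open>Quantifying over all continuous \<open>H\<close> with vanishing coefficients makes the product step of the
  induction trivial.\<close>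

lemma circle_coeff_real_polynomial_mult:
  fixes q :: "complex \<Rightarrow> real"
  assumes "real_polynomial_function q"
    and "continuous_on unit_circle H" "\<And>n. circle_coeff (\<lambda>t. H (cis t)) n = 0"
  shows "circle_coeff (\<lambda>t. H (cis t) * of_real (q (cis t))) n = 0"
  using assms
proof (induction q arbitrary: H n rule: real_polynomial_function.induct)
  case (linear q)
  note H = linear.prems
  interpret bounded_linear q by fact
  \<comment> \<open>A real-linear \<open>q\<close> equals
    \<open>cos t * q 1 + sin t * q \<i>\<close> on the circle; \<open>a\<close> and \<open>b\<close>
    are its coefficients in terms of \<open>cis t\<close> and \<open>cis (- t)\<close>. Multiplying
    \<open>H\<close> by it only combines shifted coefficients of \<open>H\<close>.\<close>
  define a b where "a = (of_real (q 1) - \<i> * of_real (q \<i>)) / 2"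
    and "b = (of_real (q 1) + \<i> * of_real (q \<i>)) / 2"
  have q: "of_real (q (cis t)) = a * cis (of_int 1 * t) + b * cis (of_int (- 1) * t)" for t
  proof -
    have "cis t = cos t *\<^sub>R 1 + sin t *\<^sub>R \<i>" by (simp add: complex_eq_iff)
    then have "q (cis t) = cos t * q 1 + sin t * q \<i>" by (simp only: add scaleR real_scaleR_def)
    then show ?thesis by (simp add: a_def b_def complex_eq_iff field_simps)
  qed
  have cont: "continuous_on {0..2 * pi} (\<lambda>t. H (cis t))"
    by (rule continuous_on_circle_compose_cis[OF H(1)])
  have "circle_coeff (\<lambda>t. H (cis t) * of_real (q (cis t))) n =
    circle_coeff (\<lambda>t. a * (cis (of_int 1 * t) * H (cis t)) + b * (cis (of_int (- 1) * t) * H (cis t))) n"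
    unfolding q by (simp add: algebra_simps)
  also have "\<dots> = a * circle_coeff (\<lambda>t. H (cis t)) (n - 1) + b * circle_coeff (\<lambda>t. H (cis t)) (n - - 1)"
    by (subst circle_coeff_add)
      (auto intro!: continuous_intros cont simp only: circle_coeff_cmult circle_coeff_cis_mult)
  also have "\<dots> = 0" using H by simp
  finally show ?case .
next
  case (const c)
  then show ?case
    using circle_coeff_cmult[of "of_real c" "\<lambda>t. H (cis t)" n] by (simp add: mult.commute)
next
  case (add f g)
  have cont: "continuous_on {0..2 * pi} (\<lambda>t. H (cis t) * of_real (h (cis t)))"
    if "real_polynomial_function h" for h
    by (intro continuous_on_circle_compose_cis continuous_on_mult_real_polynomial that add.prems)
  show ?case
    using circle_coeff_add[OF cont[OF add.hyps(1)] cont[OF add.hyps(2)], of n] add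
    by (simp add: ring_distribs)
next
  case (mult f g)
  have "continuous_on unit_circle (\<lambda>z. H z * of_real (f z))"
    by (intro continuous_on_mult_real_polynomial mult)
  from mult.IH(2)[OF this] mult.IH(1) mult.prems show ?case
    by (simp add: mult.assoc)
qed

text \<open>\<open>H\<close> integrates to 0 against every polynomial function, and
  \<open>cnj H\<close> is a uniform limit of such functions by Stone-Weierstrass. So the integral of
  \<open>\<bar>H\<bar>\<close> squared is 0, and continuity gives \<open>H = 0\<close>.\<close>

lemma circle_coeff_eq_0_imp_eq_0:
  assumes H: "continuous_on unit_circle H" "\<And>n. circle_coeff (\<lambda>t. H (cis t)) n = 0"
    and z: "z \<in> unit_circle"
  shows "H z = 0"
proof -
  define I :: "(complex \<Rightarrow> complex) \<Rightarrow> complex"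
    where "I = (\<lambda>g. integral {0..2 * pi} (\<lambda>t. H (cis t) * g (cis t)))"
  have integrable: "(\<lambda>t. H (cis t) * g (cis t)) integrable_on {0..2 * pi}"
    if "continuous_on unit_circle g" for g
    by (intro integrable_continuous_real continuous_on_mult continuous_on_circle_compose_cis H that)
  have real_poly: "I (\<lambda>z. of_real (q z)) = 0" if "real_polynomial_function q" for q
    using circle_coeff_real_polynomial_mult[OF that H, of 0] by (simp add: I_def circle_coeff_def)
  have poly: "I g = 0" if "polynomial_function g" for g
  proof -
    have q: "real_polynomial_function (Re \<circ> g)" "real_polynomial_function (Im \<circ> g)"
      using that bounded_linear_Re bounded_linear_Im by (auto simp: polynomial_function_def)
    have 1: "I (\<lambda>z. of_real ((Re \<circ> g) z)) = 0" "I (\<lambda>z. of_real ((Im \<circ> g) z)) = 0"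
      by (rule real_poly q)+
    have c: "continuous_on unit_circle (\<lambda>z. complex_of_real (Re (g z)))"
      "continuous_on unit_circle (\<lambda>z. complex_of_real (Im (g z)))"
      using that by (intro continuous_intros continuous_on_polymonial_function; simp)+
    have "I g = integral {0..2 * pi} (\<lambda>t. H (cis t) * of_real (Re (g (cis t))) +
        \<i> * (H (cis t) * of_real (Im (g (cis t)))))"
      unfolding I_def by (subst complex_eq[of "g _"]) (simp add: algebra_simps)
    also have "\<dots> = I (\<lambda>z. of_real ((Re \<circ> g) z)) + \<i> * I (\<lambda>z. of_real ((Im \<circ> g) z))"
      unfolding I_def
      by (subst integral_add) (use integrable[OF c(1)] integrable[OF c(2)] in auto)
    finally show ?thesis using 1 by simp
  qed
  have cnj_H: "continuous_on unit_circle (\<lambda>z. cnj (H z))"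
    by (intro continuous_on_cnj H)
  have "compact (H ` unit_circle)"
    by (intro compact_continuous_image H) auto
  then obtain B where B: "B > 0" "\<And>z. z \<in> unit_circle \<Longrightarrow> cmod (H z) \<le> B"
    using compact_imp_bounded bounded_pos by (metis imageI)
  have small: "cmod (I (\<lambda>z. cnj (H z))) \<le> \<epsilon>" if "\<epsilon> > 0" for \<epsilon>
  proof -
    \<comment> \<open>Chosen so that the error \<open>B * \<delta>\<close> integrated over a length
      of 2 pi is exactly \<epsilon>.\<close>
    define \<delta> where "\<delta> = \<epsilon> / (B * (2 * pi))"
    have \<delta>: "\<delta> > 0" using that B by (simp add: \<delta>_def)
    obtain g where g: "polynomial_function g" "\<And>z. z \<in> unit_circle \<Longrightarrow> cmod (cnj (H z) - g z) < \<delta>"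
      using Stone_Weierstrass_polynomial_function[OF _ cnj_H \<delta>] compact_sphere by metis
    have cont_g: "continuous_on unit_circle g"
      using g(1) by (rule continuous_on_polymonial_function)
    have "I (\<lambda>z. cnj (H z)) = I (\<lambda>z. cnj (H z)) - I g" using poly[OF g(1)] by simp
    also have "\<dots> = integral {0..2 * pi} (\<lambda>t. H (cis t) * (cnj (H (cis t)) - g (cis t)))"
      unfolding I_def
      by (subst integral_diff[symmetric])
        (use integrable[OF cnj_H] integrable[OF cont_g] in \<open>auto simp: algebra_simps\<close>)
    also have "cmod \<dots> \<le> (B * \<delta>) * (2 * pi - 0)"
    proof (rule integral_bound)
      show "continuous_on {0..2 * pi} (\<lambda>t. H (cis t) * (cnj (H (cis t)) - g (cis t)))"
        by (intro continuous_intros continuous_on_circle_compose_cis H cont_g)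
      show "cmod (H (cis t) * (cnj (H (cis t)) - g (cis t))) \<le> B * \<delta>" for t
        using B(2) less_imp_le[OF B(1)] less_imp_le[OF g(2)] by (auto simp: norm_mult intro!: mult_mono)
    qed simp
    also have "\<dots> = \<epsilon>" using B by (simp add: \<delta>_def)
    finally show ?thesis .
  qed
  have "cmod (I (\<lambda>z. cnj (H z))) \<le> 0"
    by (rule field_le_epsilon) (use small in simp)
  moreover have "I (\<lambda>z. cnj (H z)) = of_real (integral {0..2 * pi} (\<lambda>t. (cmod (H (cis t)))\<^sup>2))"
  proof -
    have "((\<lambda>t. (cmod (H (cis t)))\<^sup>2) has_integral integral {0..2 * pi} (\<lambda>t. (cmod (H (cis t)))\<^sup>2)) {0..2 * pi}"
      by (intro integrable_integral integrable_continuous_real continuous_intros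
          continuous_on_circle_compose_cis H)
    then have "((\<lambda>t. complex_of_real ((cmod (H (cis t)))\<^sup>2)) has_integral
        of_real (integral {0..2 * pi} (\<lambda>t. (cmod (H (cis t)))\<^sup>2))) {0..2 * pi}"
      by (rule has_integral_of_real)
    then show ?thesis by (simp add: I_def complex_norm_square integral_unique del: of_real_power)
  qed
  ultimately have "integral {0..2 * pi} (\<lambda>t. (cmod (H (cis t)))\<^sup>2) = 0" by simp
  then have "\<forall>t\<in>{0..2 * pi}. (cmod (H (cis t)))\<^sup>2 = 0"
    by (subst (asm) integral_eq_0_iff)
      (auto intro!: continuous_intros continuous_on_circle_compose_cis H)
  moreover have "z = cis (Arg2pi z)"
    using z by (simp add: cis_Arg2pi_unit)
  moreover have "Arg2pi z \<in> {0..2 * pi}"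
    using Arg2pi_ge_0[of z] Arg2pi_lt_2pi[of z] by simp
  ultimately show ?thesis by (metis norm_eq_zero power_eq_0_iff zero_neq_numeral)
qed

text \<open>The absolutely summable coefficients give a uniformly convergent series with continuous
  sum \<open>G\<close>. Termwise integration shows that \<open>G\<close> has the coefficients of the
  derivative, so both agree by uniqueness.\<close>

lemma fourier_series_uniform_limit:
  assumes "f \<in> smooth_circle"
  shows "uniform_limit UNIV
    (\<lambda>F t. \<Sum>n\<in>F. circle_coeff (circle_deriv k f) n * cis (of_int n * t))
    (circle_deriv k f) (finite_subsets_at_top UNIV)"
proof -
  define c where "c = circle_coeff (circle_deriv k f)"
  define G where "G = (\<lambda>z. \<Sum>\<^sub>\<infinity>n. c n * z powi n)"
  have G: "uniform_limit unit_circle (\<lambda>F z. \<Sum>n\<in>F. c n * z powi n) G (finite_subsets_at_top UNIV)"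
    unfolding G_def
    by (rule Weierstrass_m_test_general[where M = "\<lambda>n. cmod (c n)"])
      (auto simp: norm_mult norm_power_int c_def circle_coeff_abs_summable assms)
  have cont_sum: "continuous_on unit_circle (\<lambda>z. \<Sum>n\<in>F. c n * z powi n)" for F
    by (intro continuous_intros) auto
  have cont_G: "continuous_on unit_circle G"
    by (rule uniform_limit_theorem[OF _ G]) (auto intro!: always_eventually cont_sum)
  have lim: "uniform_limit UNIV (\<lambda>F t. \<Sum>n\<in>F. c n * cis (of_int n * t)) (\<lambda>t. G (cis t))
      (finite_subsets_at_top UNIV)"
    using uniform_limit_compose'[OF G, where h = cis and B = UNIV] by (simp add: cis_power_int)
  have coeff_G: "circle_coeff (\<lambda>t. G (cis t)) m = c m" for m
  proof -
    have "uniform_limit {0..2 * pi} (\<lambda>F t. cis (- of_int m * t) * (\<Sum>n\<in>F. c n * cis (of_int n * t)))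
      (\<lambda>t. cis (- of_int m * t) * G (cis t)) (finite_subsets_at_top UNIV)"
    proof (intro uniform_lim_mult uniform_limit_const uniform_limit_on_subset[OF lim])
      show "bounded ((\<lambda>t. G (cis t)) ` {0..2 * pi})"
        by (intro compact_imp_bounded compact_continuous_image
            continuous_on_circle_compose_cis cont_G) simp
    qed (auto simp: bounded_iff intro!: exI[of _ 1])
    then obtain I J where
      I: "\<And>F. ((\<lambda>t. cis (- of_int m * t) * (\<Sum>n\<in>F. c n * cis (of_int n * t))) has_integral I F) {0..2 * pi}"
      and J: "((\<lambda>t. cis (- of_int m * t) * G (cis t)) has_integral J) {0..2 * pi}"
      and IJ: "(I \<longlongrightarrow> J) (finite_subsets_at_top UNIV)"
      by (rule uniform_limit_integral) (auto intro!: continuous_intros)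
    \<comment> \<open>By orthogonality the net of integrals is constant as soon as \<open>F\<close>
      contains \<open>m\<close>.\<close>
    have "I F / of_real (2 * pi) = c m" if F: "finite F" "m \<in> F" for F
    proof -
      have "I F / of_real (2 * pi) = circle_coeff (\<lambda>t. \<Sum>n\<in>F. c n * cis (of_int n * t)) m"
        using integral_unique[OF I] by (simp add: circle_coeff_def mult.commute)
      also have "\<dots> = (\<Sum>n\<in>F. c n * (if m = n then 1 else 0))"
        using F by (subst circle_coeff_sum)
          (auto intro!: continuous_intros simp only: circle_coeff_cmult circle_coeff_cis)
      also have "\<dots> = (\<Sum>n\<in>F. if m = n then c n else 0)"
        by (intro sum.cong) auto
      also have "\<dots> = c m" using F by simp
      finally show ?thesis .
    qed
    then have "\<forall>\<^sub>F F in finite_subsets_at_top UNIV. I F / of_real (2 * pi) = c m"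
      unfolding eventually_finite_subsets_at_top by (intro exI[of _ "{m}"]) auto
    moreover have "((\<lambda>F. I F / of_real (2 * pi)) \<longlongrightarrow> J / of_real (2 * pi)) (finite_subsets_at_top UNIV)"
      by (intro tendsto_divide IJ tendsto_const) simp
    ultimately have "((\<lambda>F. c m) \<longlongrightarrow> J / of_real (2 * pi)) (finite_subsets_at_top (UNIV :: int set))"
      by (rule Lim_transform_eventually[rotated])
    then have "J / of_real (2 * pi) = c m"
      by (simp add: tendsto_const_iff)
    then show ?thesis
      using integral_unique[OF J] by (simp add: circle_coeff_def mult.commute)
  qed
  have fun_cis: "circle_fun k f (cis t) = circle_deriv k f t" for t
    by (simp add: circle_fun_def circle_deriv_Arg_cis assms)
  \<comment> \<open>Uniqueness concerns continuous functions on the circle, hence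
    \<open>circle_fun\<close> in place of the derivative as a function of the angle.\<close>
  have "circle_fun k f z - G z = 0" if "z \<in> unit_circle" for z
  proof (rule circle_coeff_eq_0_imp_eq_0[OF _ _ that])
    show "continuous_on unit_circle (\<lambda>z. circle_fun k f z - G z)"
      by (intro continuous_intros continuous_on_circle_fun assms cont_G)
    show "circle_coeff (\<lambda>t. circle_fun k f (cis t) - G (cis t)) n = 0" for n
      unfolding fun_cis
      by (subst circle_coeff_diff)
        (auto simp: coeff_G c_def intro!: continuous_on_circle_deriv assms
          continuous_on_circle_compose_cis cont_G)
  qed
  then have "(\<lambda>t. G (cis t)) = circle_deriv k f"
    using fun_cis by (auto simp: fun_eq_iff)
  with lim show ?thesis by (simp add: c_def)
qed

lemma circle_coeff_circle_deriv:
  "f \<in> smooth_circle \<Longrightarrow>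
    circle_coeff (circle_deriv k f) n = (\<i> * of_int n) ^ k * circle_coeff (circle_deriv 0 f) n"
  by (induction k) (simp_all add: circle_coeff_deriv del: circle_deriv_0)

section \<open>Expansion of a distribution in its Fourier coefficients\<close>

lemma circle_distribution_sum:
  assumes "circle_distribution S" "finite A" "\<And>i. i \<in> A \<Longrightarrow> f i \<in> smooth_circle"
  shows "S (\<lambda>z. \<Sum>i\<in>A. c i * f i z) = (\<Sum>i\<in>A. c i * S (f i))"
proof -
  have add: "S (\<lambda>z. g z + h z) = S g + S h" if "g \<in> smooth_circle" "h \<in> smooth_circle" for g h
    using assms(1) that by (simp add: circle_distribution_def)
  have scale: "S (\<lambda>z. c * g z) = c * S g" if "g \<in> smooth_circle" for c g
    using assms(1) that by (simp add: circle_distribution_def)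
  show ?thesis
    using assms(2,3)
  proof (induction A rule: finite_induct)
    case empty
    \<comment> \<open>The empty sum is the zero function, which is 0 times itself.\<close>
    from scale[OF smooth_circle_zero, of 0] show ?case by simp
  next
    case (insert a A)
    have "(\<lambda>z. c a * f a z) \<in> smooth_circle"
      using insert by (intro smooth_circle_cmult) simp
    moreover have "(\<lambda>z. \<Sum>i\<in>A. c i * f i z) \<in> smooth_circle"
      using insert by (intro smooth_circle_sum) auto
    ultimately show ?case
      using add scale[of "f a" "c a"] insert by simp
  qed
qed

text \<open>The partial sums of the Fourier series converge to \<open>f\<close> with every
  derivative, that is, in the topology of smooth functions, and \<open>S\<close> is continuous and
  linear.\<close>

lemma circle_distribution_has_sum:
  assumes S: "circle_distribution S" and f: "f \<in> smooth_circle"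
  shows "((\<lambda>n. circle_coeff (circle_deriv 0 f) n * fourier_coeff S (- n)) has_sum S f) UNIV"
proof -
  define c where "c = circle_coeff (circle_deriv 0 f)"
  \<comment> \<open>On the circle \<open>cnj z powi (- n)\<close> is the n-th power of
    \<open>z\<close>; in this form \<open>S\<close> maps it to \<open>fourier_coeff S (- n)\<close>
    by definition.\<close>
  define P where "P = (\<lambda>F z. \<Sum>n\<in>F. c n * cnj z powi (- n))"
  have P: "P F \<in> smooth_circle" if "finite F" for F
    unfolding P_def using that by (intro smooth_circle_sum smooth_circle_cnj_powi)
  have lim: "uniform_limit UNIV (\<lambda>F. circle_deriv k (P F)) (circle_deriv k f) (finite_subsets_at_top UNIV)" for k
  proof -
    have "\<forall>\<^sub>F F in finite_subsets_at_top UNIV. \<forall>t\<in>UNIV.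
        (\<Sum>n\<in>F. circle_coeff (circle_deriv k f) n * cis (of_int n * t)) = circle_deriv k (P F) t"
    proof (rule eventually_finite_subsets_at_top_weakI, rule ballI)
      fix F :: "int set" and t assume F: "finite F"
      \<comment> \<open>Differentiating a partial sum \<open>k\<close> times gives the partial sum
        of the series of the k-th derivative, since both multiply the n-th coefficient by
        \<open>(\<i> * of_int n) ^ k\<close>.\<close>
      have "circle_deriv k (P F) t = (\<Sum>n\<in>F. c n * ((\<i> * of_int n) ^ k * cis (of_int n * t)))"
        unfolding P_def
        using circle_deriv_sum[OF F, of "\<lambda>n z. cnj z powi (- n)" k c]
        by (simp add: smooth_circle_cnj_powi circle_deriv_cnj_powi)
      also have "\<dots> = (\<Sum>n\<in>F. circle_coeff (circle_deriv k f) n * cis (of_int n * t))"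
        using circle_coeff_circle_deriv[OF f, of k] by (simp add: c_def mult_ac)
      finally show "(\<Sum>n\<in>F. circle_coeff (circle_deriv k f) n * cis (of_int n * t)) =
          circle_deriv k (P F) t" by simp
    qed
    with fourier_series_uniform_limit[OF f, of k] show ?thesis
      using uniform_limit_cong by fast
  qed
  have "limitin smooth_circle_topology P f (finite_subsets_at_top UNIV)"
    unfolding limitin_def topspace_smooth_circle_topology openin_smooth_circle_topology
  proof (intro conjI allI impI f)
    fix U assume U: "smooth_circle_open U \<and> f \<in> U"
    then obtain N \<epsilon> where "\<epsilon> > 0" and N: "\<forall>g\<in>smooth_circle.
        (\<forall>k\<le>N. \<forall>t. cmod (circle_deriv k g t - circle_deriv k f t) < \<epsilon>) \<longrightarrow> g \<in> U"
      unfolding smooth_circle_open_def by metis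
    \<comment> \<open>A basic neighbourhood constrains only the derivatives up to order
      \<open>N\<close>, so finitely many uniform limits are combined.\<close>
    have "\<forall>\<^sub>F F in finite_subsets_at_top UNIV.
        \<forall>k\<in>{..N}. \<forall>t. cmod (circle_deriv k (P F) t - circle_deriv k f t) < \<epsilon>"
      using uniform_limitD[OF lim \<open>\<epsilon> > 0\<close>]
      by (intro eventually_ball_finite) (simp_all add: dist_norm)
    moreover have "\<forall>\<^sub>F F in finite_subsets_at_top UNIV. P F \<in> smooth_circle"
      by (intro eventually_finite_subsets_at_top_weakI P)
    ultimately show "\<forall>\<^sub>F F in finite_subsets_at_top UNIV. P F \<in> U"
      by eventually_elim (use N in auto)
  qed
  moreover have "continuous_map smooth_circle_topology euclidean S"
    using S by (simp add: circle_distribution_def)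
  ultimately have "((\<lambda>F. S (P F)) \<longlongrightarrow> S f) (finite_subsets_at_top UNIV)"
    using continuous_map_limit by (fastforce simp: o_def)
  moreover have "\<forall>\<^sub>F F in finite_subsets_at_top UNIV. S (P F) = (\<Sum>n\<in>F. c n * fourier_coeff S (- n))"
    unfolding P_def fourier_coeff_def
    by (intro eventually_finite_subsets_at_top_weakI circle_distribution_sum S smooth_circle_cnj_powi)
  ultimately show ?thesis
    unfolding has_sum_def c_def by (rule Lim_transform_eventually)
qed

subsection \<open>Test functions with prescribed Fourier coefficients\<close>

text \<open>The family \<open>p(1/x) exp(-1/x)\<close>, extended by 0 to \<open>x \<le> 0\<close>, is closed under differentiation.\<close>

definition flat :: "real poly \<Rightarrow> real \<Rightarrow> real" where
  "flat p x = (if x \<le> 0 then 0 else poly p (1 / x) * exp (- (1 / x)))"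

lemma tendsto_poly_mult_exp_minus:
  fixes p :: "real poly"
  shows "((\<lambda>y. poly p y * exp (- y)) \<longlongrightarrow> 0) at_top"
proof -
  \<comment> \<open>The additional power absorbs the factor \<open>y\<close> that
    \<open>pCons\<close> puts in front of \<open>p\<close>.\<close>
  have "((\<lambda>y. y ^ k * poly p y * exp (- y)) \<longlongrightarrow> 0) at_top" for k
  proof (induction p arbitrary: k)
    case (pCons a p)
    have "((\<lambda>y. a * (y ^ k / exp y) + y ^ Suc k * poly p y * exp (- y)) \<longlongrightarrow> a * 0 + 0) at_top"
      by (intro tendsto_intros tendsto_power_div_exp_0 pCons.IH)
    then show ?case
      by (simp add: exp_minus field_simps)
  qed simp
  from this[of 0] show ?thesis by simp
qed

text \<open>With y = 1/x one has dy/dx = -y^2, so p(y) exp(-y) differentiates to y^2 (p(y) - p'(y))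
  exp(-y); the polynomial in the statement is X^2 (p - p').\<close>

lemma flat_has_derivative:
  "(flat p has_real_derivative flat ([:0, 0, 1:] * (p - pderiv p)) x) (at x)"
proof -
  consider "x < 0" | "x > 0" | "x = 0" by linarith
  then show ?thesis
  proof cases
    case 1
    have "((\<lambda>x. 0) has_real_derivative 0) (at x)" by simp
    then have "(flat p has_real_derivative 0) (at x)"
      by (rule has_field_derivative_transform_within_open[of _ _ _ "{..<0}"])
        (use 1 in \<open>auto simp: flat_def\<close>)
    with 1 show ?thesis by (simp add: flat_def)
  next
    case 2
    have "((\<lambda>x. poly p (1 / x) * exp (- (1 / x))) has_real_derivative
        flat ([:0, 0, 1:] * (p - pderiv p)) x) (at x)"
      using 2 by (auto intro!: derivative_eq_intros poly_DERIV[THEN DERIV_chain2]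
          simp: flat_def field_simps power2_eq_square)
    then show ?thesis
      by (rule has_field_derivative_transform_within_open[of _ _ _ "{0<..}"])
        (use 2 in \<open>auto simp: flat_def\<close>)
  next
    case 3
    \<comment> \<open>For h > 0 and y = 1/h, the difference quotient \<open>flat p h / h\<close> is
      y p(y) exp(-y), which explains \<open>pCons 0 p\<close>.\<close>
    have "((\<lambda>y. poly (pCons 0 p) y * exp (- y)) \<longlongrightarrow> 0) at_top"
      by (rule tendsto_poly_mult_exp_minus)
    then have "((\<lambda>h. poly (pCons 0 p) (inverse h) * exp (- inverse h)) \<longlongrightarrow> 0) (at_right 0)"
      by (rule filterlim_compose[OF _ filterlim_inverse_at_top_right])
    moreover have "\<forall>\<^sub>F h in at_right 0. poly (pCons 0 p) (inverse h) * exp (- inverse h) = flat p h / h"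
      using eventually_at_right_less[of 0]
      by eventually_elim (auto simp: flat_def field_simps)
    ultimately have "((\<lambda>h. flat p h / h) \<longlongrightarrow> 0) (at_right 0)"
      by (rule Lim_transform_eventually)
    moreover have "\<forall>\<^sub>F h in at_left 0. 0 = flat p h / h"
      unfolding eventually_at_filter by (auto simp: flat_def)
    then have "((\<lambda>h. flat p h / h) \<longlongrightarrow> 0) (at_left 0)"
      by (rule Lim_transform_eventually[OF tendsto_const])
    ultimately show ?thesis
      using 3 by (simp add: has_field_derivative_iff filterlim_at_split flat_def)
  qed
qed

text \<open>A set of functions closed under differentiation, as needed for
  \<open>smooth_circle_coinduct\<close>: \<open>Re (cis t * cnj a) - r\<close> is positive exactly on an arc around \<open>a\<close>.\<close>

inductive_set circle_flat :: "complex \<Rightarrow> real \<Rightarrow> (real \<Rightarrow> complex) set" for a r where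
  base: "(\<lambda>t. c * cis (of_int n * t) * of_real (flat p (Re (cis t * cnj a) - r))) \<in> circle_flat a r"
| add: "f \<in> circle_flat a r \<Longrightarrow> g \<in> circle_flat a r \<Longrightarrow> (\<lambda>t. f t + g t) \<in> circle_flat a r"

lemma circle_flat_has_derivative:
  assumes "f \<in> circle_flat a r"
  shows "\<exists>f'\<in>circle_flat a r. \<forall>t. (f has_vector_derivative f' t) (at t)"
  using assms
proof induction
  case (base c n p)
  define q where "q = [:0, 0, 1:] * (p - pderiv p)"
  \<comment> \<open>Chosen so that the derivative \<open>u'\<close> of \<open>u\<close> is
    \<open>b * cis t + cnj b * cis (- t)\<close>. Multiplication by \<open>u'\<close> then moves the
    frequency \<open>n\<close> to \<open>n + 1\<close> and \<open>n - 1\<close>, which yields the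
    last two terms of \<open>f'\<close>.\<close>
  define b where "b = \<i> * cnj a / 2"
  define u where "u = (\<lambda>t. Re (cis t * cnj a) - r)"
  define u' where "u' = (\<lambda>t. Re (\<i> * cis t * cnj a))"
  let ?B = "\<lambda>c n p t. c * cis (of_int n * t) * of_real (flat p (u t))"
  define f' where "f' = (\<lambda>t. (?B (c * \<i> * of_int n) n p t + ?B (c * b) (n + 1) q t) + ?B (c * cnj b) (n - 1) q t)"
  have "f' \<in> circle_flat a r"
    unfolding f'_def u_def by (intro circle_flat.intros)
  moreover have "(?B c n p has_vector_derivative f' t) (at t)" for t
  proof -
    have "u = (\<lambda>t. cos t * Re a + sin t * Im a - r)" "u' t = cos t * Im a - sin t * Re a"
      by (auto simp: u_def u'_def)
    then have "(u has_real_derivative u' t) (at t)"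
      by (auto intro!: derivative_eq_intros)
    from DERIV_chain2[OF flat_has_derivative[of p] this]
    have "((\<lambda>t. flat p (u t)) has_vector_derivative flat q (u t) * u' t) (at t)"
      by (simp add: has_real_derivative_iff_has_vector_derivative q_def)
    then have "((\<lambda>t. complex_of_real (flat p (u t))) has_vector_derivative of_real (flat q (u t) * u' t)) (at t)"
      by (rule bounded_linear.has_vector_derivative[OF bounded_linear_of_real])
    from has_vector_derivative_mult[OF has_vector_derivative_mult_right[OF cis_has_vector_derivative] this]
    have "(?B c n p has_vector_derivative
        (c * cis (of_int n * t)) * of_real (flat q (u t) * u' t) +
        (c * (\<i> * of_real (of_int n) * cis (of_int n * t))) * of_real (flat p (u t))) (at t)" .
    moreover have "complex_of_real (u' t) = b * cis t + cnj b * cis (- t)"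
      by (simp add: u'_def b_def complex_eq_iff field_simps)
    moreover have "cis (of_int (n + 1) * t) = cis (of_int n * t) * cis t"
      "cis (of_int (n - 1) * t) = cis (of_int n * t) * cis (- t)"
      by (simp_all add: cis_mult algebra_simps)
    ultimately show ?thesis by (simp add: f'_def algebra_simps)
  qed
  ultimately show ?case unfolding u_def by blast
next
  case (add f g)
  then obtain f' g' where "f' \<in> circle_flat a r" "g' \<in> circle_flat a r"
    "\<forall>t. (f has_vector_derivative f' t) (at t)" "\<forall>t. (g has_vector_derivative g' t) (at t)"
    by blast
  then show ?case
    by (intro bexI[of _ "\<lambda>t. f' t + g' t"] circle_flat.add)
      (auto intro: has_vector_derivative_add)
qed

text \<open>A nonnegative bump around \<open>a\<close> times the m-th power of \<open>z\<close>: the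
  m-th coefficient is the mean of the bump, which is positive because the bump is positive at
  \<open>a\<close>.\<close>

lemma circle_bump:
  assumes a: "a \<in> unit_circle" and r: "r < 1"
  obtains f where "f \<in> smooth_circle" "\<And>z. Re (z * cnj a) \<le> r \<Longrightarrow> f z = 0"
    "circle_coeff (circle_deriv 0 f) m \<noteq> 0"
proof -
  define h where "h = (\<lambda>z. flat 1 (Re (z * cnj a) - r))"
  define f where "f = (\<lambda>z. z powi m * complex_of_real (h z))"
  have f_cis: "f (cis t) = cis (of_int m * t) * of_real (h (cis t))" for t
    by (simp add: f_def cis_power_int)
  have smooth: "f \<in> smooth_circle"
  proof (rule smooth_circle_coinduct)
    show "(\<lambda>t. f (cis t)) \<in> circle_flat a r"
      using circle_flat.base[of 1 m 1 a r] by (simp add: f_cis h_def)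
  qed (rule circle_flat_has_derivative)
  have cont: "continuous_on {0..2 * pi} (\<lambda>t. h (cis t))"
    unfolding h_def
    by (rule continuous_on_compose2[of UNIV "flat 1"])
      (use flat_has_derivative[THEN DERIV_isCont] continuous_on_cis_mult[of _ 1] in
        \<open>auto intro!: continuous_intros continuous_at_imp_continuous_on\<close>)
  have int: "((\<lambda>t. complex_of_real (h (cis t))) has_integral of_real (integral {0..2 * pi} (\<lambda>t. h (cis t)))) {0..2 * pi}"
    by (intro has_integral_of_real integrable_integral integrable_continuous_real cont)
  have "circle_coeff (circle_deriv 0 f) m = circle_coeff (\<lambda>t. of_real (h (cis t))) 0"
    using circle_coeff_cis_mult[of m "\<lambda>t. of_real (h (cis t))" m]
    by (simp add: f_cis circle_coeff_def)
  also have "\<dots> = of_real (integral {0..2 * pi} (\<lambda>t. h (cis t)) / (2 * pi))"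
    using integral_unique[OF int] by (simp add: circle_coeff_def)
  finally have *: "circle_coeff (circle_deriv 0 f) m = \<dots>" .
  have "integral {0..2 * pi} (\<lambda>t. h (cis t)) \<noteq> 0"
  proof
    assume "integral {0..2 * pi} (\<lambda>t. h (cis t)) = 0"
    then have "\<forall>t\<in>{0..2 * pi}. h (cis t) = 0"
      using cont by (subst (asm) integral_eq_0_iff) (auto simp: h_def flat_def)
    moreover have "a = cis (Arg2pi a)"
      using a by (simp add: cis_Arg2pi_unit)
    moreover have "Arg2pi a \<in> {0..2 * pi}"
      using Arg2pi_ge_0[of a] Arg2pi_lt_2pi[of a] by simp
    ultimately have "h a = 0" by metis
    moreover have "Re (a * cnj a) = 1"
      using a by (simp add: complex_mult_cnj cmod_def flip: complex_norm_square)
    ultimately show False using r by (simp add: h_def flat_def)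
  qed
  with * have "circle_coeff (circle_deriv 0 f) m \<noteq> 0" by simp
  moreover have "f z = 0" if "Re (z * cnj a) \<le> r" for z
    using that by (simp add: f_def h_def flat_def)
  ultimately show ?thesis using that smooth by blast
qed

text \<open>The operator \<open>d/dt - \<i> j\<close> does not enlarge supports and kills exactly the \<open>j\<close>-th coefficient.\<close>

lemma circle_coeff_annihilate:
  assumes "finite J" "f \<in> smooth_circle" "closed F" "\<And>z. z \<in> unit_circle - F \<Longrightarrow> f z = 0"
  shows "\<exists>g\<in>smooth_circle. (\<forall>z\<in>unit_circle - F. g z = 0) \<and>
    (\<forall>n. circle_coeff (circle_deriv 0 g) n =
      (\<Prod>j\<in>J. \<i> * of_int (n - j)) * circle_coeff (circle_deriv 0 f) n)"
  using assms(1)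
proof (induction J rule: finite_induct)
  case empty
  show ?case by (rule bexI[OF _ assms(2)]) (use assms(4) in auto)
next
  case (insert j J)
  then obtain g where g: "g \<in> smooth_circle" "\<And>z. z \<in> unit_circle - F \<Longrightarrow> g z = 0"
    and coeff: "\<And>n. circle_coeff (circle_deriv 0 g) n =
      (\<Prod>j\<in>J. \<i> * of_int (n - j)) * circle_coeff (circle_deriv 0 f) n" by blast
  \<comment> \<open>The operator applied to \<open>g\<close>, as a function on the circle;
    \<open>d\<close> lists its derivatives.\<close>
  define h where "h = (\<lambda>z. circle_fun 1 g z - \<i> * of_int j * g z)"
  define d where "d = (\<lambda>k t. circle_deriv (Suc k) g t - \<i> * of_int j * circle_deriv k g t)"
  have d: "d 0 t = h (cis t)" "(d k has_vector_derivative d (Suc k) t) (at t)" for k t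
    unfolding d_def h_def
    by (auto simp: circle_fun_def circle_deriv_Arg_cis g
        intro!: derivative_eq_intros circle_deriv_has_vector_derivative)
  have h: "h \<in> smooth_circle" "circle_deriv k h = d k" for k
    using circle_deriv_unique[where d = d, OF d] by auto
  have "h z = 0" if z: "z \<in> unit_circle - F" for z
  proof -
    \<comment> \<open>As \<open>F\<close> is closed, \<open>g\<close> vanishes on an open set of
      angles, so its derivative does too.\<close>
    let ?T = "{t. cis t \<notin> F}"
    have z_eq: "z = cis (Arg z)" using z by (simp add: cis_Arg_unit)
    have "open (cis -` (- F))"
      using assms(3) continuous_on_cis_mult[of UNIV 1] by (intro open_vimage) auto
    then have T: "open ?T" by (simp add: vimage_def)
    have "((\<lambda>t. 0) has_vector_derivative (0 :: complex)) (at (Arg z))" by simp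
    then have "(circle_deriv 0 g has_vector_derivative 0) (at (Arg z))"
      by (rule has_vector_derivative_transform_within_open[OF _ T])
        (use z z_eq g(2) in auto)
    then have "circle_deriv 1 g (Arg z) = 0"
      using circle_deriv_has_vector_derivative[OF g(1), of 0 "Arg z"] vector_derivative_unique_at
      by fastforce
    then show ?thesis using g(2)[OF z] by (simp add: h_def circle_fun_def)
  qed
  moreover have "circle_coeff (circle_deriv 0 h) n =
      (\<Prod>j\<in>insert j J. \<i> * of_int (n - j)) * circle_coeff (circle_deriv 0 f) n" for n
  proof -
    have "circle_coeff (d 0) n =
        circle_coeff (circle_deriv (Suc 0) g) n - \<i> * of_int j * circle_coeff (circle_deriv 0 g) n"
      unfolding d_def
      by (subst circle_coeff_diff)
        (auto simp only: circle_coeff_cmult intro!: continuous_intros continuous_on_circle_deriv g)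
    also have "\<dots> = \<i> * of_int (n - j) * circle_coeff (circle_deriv 0 g) n"
      unfolding circle_coeff_deriv[OF g(1)] by (simp add: algebra_simps)
    finally show ?thesis
      unfolding h(2) coeff using insert by (simp add: mult.assoc)
  qed
  ultimately show ?case using h(1) by blast
qed

definition is_test_function :: "complex set \<Rightarrow> int \<Rightarrow> int \<Rightarrow> (complex \<Rightarrow> complex) \<Rightarrow> bool" where
  "is_test_function V N m f \<longleftrightarrow> f \<in> smooth_circle \<and>
     closure {z \<in> unit_circle. f z \<noteq> 0} \<subseteq> V \<and>
     circle_coeff (circle_deriv 0 f) m = 1 \<and>
     (\<forall>n. \<bar>n\<bar> \<le> N \<longrightarrow> n \<noteq> m \<longrightarrow> circle_coeff (circle_deriv 0 f) n = 0)"

text \<open>A bump in a small closed cap inside \<open>V\<close> has nonzero m-th coefficient. The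
  other coefficients of index at most \<open>N\<close> in absolute value are annihilated without
  enlarging the cap, and the result is normalised.\<close>

lemma exists_test_function:
  assumes V: "open V" "V \<inter> unit_circle \<noteq> {}"
  shows "\<exists>f. is_test_function V N m f"
proof -
  obtain a \<epsilon> where a: "a \<in> unit_circle" and \<epsilon>: "\<epsilon> > 0" "ball a \<epsilon> \<subseteq> V"
    using V by (meson Int_iff equals0I open_contains_ball)
  \<comment> \<open>For unit \<open>z\<close> and \<open>a\<close>, the squared distance is
    \<open>2 - 2 * Re (z * cnj a)\<close>, so the cap given by \<open>r\<close> has squared distance
    at most half of \<epsilon> squared from \<open>a\<close> and lies in the ball.\<close>
  define r where "r = 1 - \<epsilon>\<^sup>2 / 4"
  define F where "F = {z. r \<le> Re (z * cnj a)}"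
  have "closed F"
    unfolding F_def by (intro closed_Collect_le continuous_intros)
  have F: "F \<inter> unit_circle \<subseteq> V"
  proof
    fix z assume z: "z \<in> F \<inter> unit_circle"
    have "(cmod (z - a))\<^sup>2 = (cmod z)\<^sup>2 + (cmod a)\<^sup>2 - 2 * Re (z * cnj a)"
      unfolding cmod_power2 by (simp add: power2_eq_square algebra_simps)
    also have "\<dots> < \<epsilon>\<^sup>2"
    proof -
      have "1 - \<epsilon>\<^sup>2 / 4 \<le> Re (z * cnj a)" "cmod z = 1" "cmod a = 1"
        using z a by (auto simp: F_def r_def)
      then show ?thesis
        using zero_less_power[OF \<epsilon>(1), of 2] by (simp only: power_one)
    qed
    finally have "cmod (z - a) < \<epsilon>"
      using \<epsilon>(1) by (auto intro: power_less_imp_less_base)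
    then show "z \<in> V" using \<epsilon>(2) by (auto simp: dist_norm norm_minus_commute)
  qed
  obtain f where f: "f \<in> smooth_circle" "\<And>z. Re (z * cnj a) \<le> r \<Longrightarrow> f z = 0"
    "circle_coeff (circle_deriv 0 f) m \<noteq> 0"
    using circle_bump[OF a, of r m] \<epsilon> by (auto simp: r_def)
  define J where "J = {-N..N} - {m}"
  have "\<exists>g\<in>smooth_circle. (\<forall>z\<in>unit_circle - F. g z = 0) \<and>
    (\<forall>n. circle_coeff (circle_deriv 0 g) n =
      (\<Prod>j\<in>J. \<i> * of_int (n - j)) * circle_coeff (circle_deriv 0 f) n)"
    by (rule circle_coeff_annihilate[OF _ f(1) \<open>closed F\<close>]) (auto simp: J_def F_def intro: f(2))
  then obtain g where g: "g \<in> smooth_circle" "\<And>z. z \<in> unit_circle - F \<Longrightarrow> g z = 0"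
    and coeff: "\<And>n. circle_coeff (circle_deriv 0 g) n =
      (\<Prod>j\<in>J. \<i> * of_int (n - j)) * circle_coeff (circle_deriv 0 f) n" by blast
  define c where "c = circle_coeff (circle_deriv 0 g) m"
  \<comment> \<open>Since \<open>m\<close> is not in \<open>J\<close>, no factor of the product
    vanishes at \<open>m\<close>.\<close>
  have "c \<noteq> 0" using f(3) by (simp add: c_def coeff J_def)
  define h where "h = (\<lambda>z. (1 / c) * g z)"
  have h: "h \<in> smooth_circle" "circle_deriv 0 h = (\<lambda>t. (1 / c) * circle_deriv 0 g t)"
    using smooth_circle_cmult[OF g(1), of "1 / c"] by (auto simp: h_def)
  have coeff_h: "circle_coeff (circle_deriv 0 h) n = (1 / c) * circle_coeff (circle_deriv 0 g) n" for n
    unfolding h(2) by (rule circle_coeff_cmult)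
  have "{z \<in> unit_circle. h z \<noteq> 0} \<subseteq> F \<inter> unit_circle"
    using g(2) by (auto simp: h_def)
  then have "closure {z \<in> unit_circle. h z \<noteq> 0} \<subseteq> F \<inter> unit_circle"
    by (rule closure_minimal) (intro closed_Int \<open>closed F\<close> closed_sphere)
  moreover have "circle_coeff (circle_deriv 0 h) m = 1"
    using \<open>c \<noteq> 0\<close> unfolding coeff_h c_def by simp
  moreover have "circle_coeff (circle_deriv 0 h) n = 0" if "\<bar>n\<bar> \<le> N" "n \<noteq> m" for n
  proof -
    have "n \<in> J" "finite J" using that by (auto simp: J_def)
    then show ?thesis unfolding coeff_h coeff by (auto simp: prod_zero_iff)
  qed
  ultimately show ?thesis using h(1) F unfolding is_test_function_def by blast
qed

subsection \<open>Weights that are constant up to a bounded error on long blocks\<close>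

text \<open>On the block from \<open>s k\<close> to \<open>s (Suc k)\<close> the weight is about
  \<open>M (s k)\<close>, and the block is long enough to contribute at least 1/2 to the sum of
  reciprocals. The required jumps take place at the block starts.\<close>

lemma exists_slow_weight_with_jumps:
  fixes G :: "nat \<Rightarrow> real"
  shows "\<exists>lam :: nat \<Rightarrow> real. (\<forall>n. lam n > 0) \<and> strict_mono lam \<and>
    filterlim lam at_top sequentially \<and>
    filterlim (\<lambda>N. \<Sum>n<N. 1 / lam n) at_top sequentially \<and>
    (\<forall>n0. \<exists>N\<ge>n0. \<forall>n\<ge>N. G N \<le> lam n)"
proof -
  \<comment> \<open>A monotone majorant of \<open>G\<close>; the summand \<open>N\<close> makes it,
    and hence the weight, unbounded.\<close>
  define M where "M = (\<lambda>N. N + (\<Sum>i\<le>N. nat \<lceil>G i\<rceil>))"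
  have M_ge: "N \<le> M N" for N by (simp add: M_def)
  have M_mono: "M i \<le> M j" if "i \<le> j" for i j
    unfolding M_def using that by (intro add_mono sum_mono2) auto
  have G_le: "G N \<le> real (M N)" for N
  proof -
    have "nat \<lceil>G N\<rceil> \<le> (\<Sum>i\<le>N. nat \<lceil>G i\<rceil>)" by (rule member_le_sum) auto
    then have "nat \<lceil>G N\<rceil> \<le> M N" by (simp add: M_def)
    then show ?thesis by linarith
  qed
  \<comment> \<open>Block starts: the block starting at \<open>x\<close> has length
    \<open>M x + 1\<close>.\<close>
  define s where "s = rec_nat 0 (\<lambda>_ x. x + M x + 1)"
  have s_0: "s 0 = 0" and s_Suc: "s (Suc k) = s k + M (s k) + 1" for k
    by (simp_all add: s_def)
  have s_mono: "strict_mono s" by (rule strict_mono_Suc_iff[THEN iffD2]) (simp add: s_Suc)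
  have s_ge: "k \<le> s k" for k using s_mono by (rule strict_mono_imp_increasing)
  \<comment> \<open>The start of the block that contains \<open>n\<close>.\<close>
  define b where "b = (\<lambda>n. Max {x \<in> range s. x \<le> n})"
  have fin: "finite {x \<in> range s. x \<le> n}" "{x \<in> range s. x \<le> n} \<noteq> {}" for n
  proof -
    show "finite {x \<in> range s. x \<le> n}" by (rule finite_subset[of _ "{..n}"]) auto
    have "s 0 \<in> {x \<in> range s. x \<le> n}" using s_0 by simp
    then show "{x \<in> range s. x \<le> n} \<noteq> {}" by blast
  qed
  have b_mono: "b m \<le> b n" if "m \<le> n" for m n
    unfolding b_def using that fin by (intro Max_mono) auto
  have b_s: "b n = s k" if "s k \<le> n" "n < s (Suc k)" for k n
    unfolding b_def
  proof (rule Max_eqI[OF fin(1)])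
    fix y assume "y \<in> {x \<in> range s. x \<le> n}"
    then obtain j where j: "y = s j" "s j \<le> n" by auto
    then have "s j < s (Suc k)" using that by simp
    then have "j < Suc k" using s_mono by (simp add: strict_mono_less)
    then show "y \<le> s k" using j s_mono by (simp add: strict_mono_less_eq)
  qed (use that in auto)
  \<comment> \<open>The term \<open>- 1 / real (Suc n)\<close> makes the weight strictly increasing
    within a block and keeps it between \<open>M (b n) + 1\<close> and
    \<open>M (b n) + 2\<close>.\<close>
  define lam where "lam = (\<lambda>n. real (M (b n)) + 2 - 1 / real (Suc n))"
  have lam_bounds: "real (M (b n)) + 1 \<le> lam n" "lam n \<le> real (M (b n)) + 2" for n
    by (auto simp: lam_def field_simps)
  have pos: "lam n > 0" for n using lam_bounds(1)[of n] by linarith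
  have mono: "strict_mono lam"
  proof (rule strict_monoI)
    fix m n :: nat assume "m < n"
    then have "M (b m) \<le> M (b n)" by (intro M_mono b_mono) simp
    moreover have "1 / real (Suc n) < 1 / real (Suc m)"
      using \<open>m < n\<close> by (simp add: field_simps)
    ultimately show "lam m < lam n" unfolding lam_def by linarith
  qed
  have ge: "real (M (s k)) \<le> lam n" if "s k \<le> n" for k n
  proof -
    have "s k \<le> b n" unfolding b_def using fin that by (intro Max_ge) auto
    then have "M (s k) \<le> M (b n)" by (rule M_mono)
    then show ?thesis using lam_bounds(1)[of n] by linarith
  qed
  have "filterlim lam at_top sequentially"
    unfolding filterlim_at_top_ge[where c = 0]
  proof (intro allI impI)
    fix Z :: real
    obtain k where k: "Z \<le> real k" using real_arch_simple by blast
    show "\<forall>\<^sub>F n in sequentially. Z \<le> lam n"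
      using eventually_ge_at_top[of "s k"]
    proof eventually_elim
      case (elim n)
      have "real k \<le> real (M (s k))" using s_ge[of k] M_ge[of "s k"] by linarith
      then show ?case using ge[OF elim] k by linarith
    qed
  qed
  moreover have "filterlim (\<lambda>N. \<Sum>n<N. 1 / lam n) at_top sequentially"
    unfolding filterlim_at_top
  proof
    have block: "real k / 2 \<le> (\<Sum>n<s k. 1 / lam n)" for k
    proof (induction k)
      case (Suc k)
      have "1 / 2 \<le> real (M (s k) + 1) / (real (M (s k)) + 2)" by (simp add: field_simps)
      also have "\<dots> = (\<Sum>n\<in>{s k..<s (Suc k)}. 1 / (real (M (s k)) + 2))"
        by (simp add: s_Suc)
      also have "\<dots> \<le> (\<Sum>n\<in>{s k..<s (Suc k)}. 1 / lam n)"
      proof (rule sum_mono)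
        fix n assume "n \<in> {s k..<s (Suc k)}"
        then have "b n = s k" using b_s by simp
        then show "1 / (real (M (s k)) + 2) \<le> 1 / lam n"
          using lam_bounds(2)[of n] pos[of n] by (intro divide_left_mono) auto
      qed
      finally have "1 / 2 \<le> (\<Sum>n\<in>{s k..<s (Suc k)}. 1 / lam n)" .
      moreover have "(\<Sum>n<s (Suc k). 1 / lam n) =
          (\<Sum>n<s k. 1 / lam n) + (\<Sum>n\<in>{s k..<s (Suc k)}. 1 / lam n)"
        using sum.atLeastLessThan_concat[of 0 "s k" "s (Suc k)" "\<lambda>n. 1 / lam n"]
        by (simp add: lessThan_atLeast0 s_Suc)
      ultimately show ?case using Suc by (simp add: field_simps)
    qed (simp add: s_0)
    fix Z :: real
    obtain k where k: "2 * Z \<le> real k" using real_arch_simple by blast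
    show "\<forall>\<^sub>F N in sequentially. Z \<le> (\<Sum>n<N. 1 / lam n)"
      using eventually_ge_at_top[of "s k"]
    proof eventually_elim
      case (elim N)
      have "(\<Sum>n<s k. 1 / lam n) \<le> (\<Sum>n<N. 1 / lam n)"
        using elim pos by (intro sum_mono2) (auto intro: less_imp_le)
      then show ?case using block[of k] k by linarith
    qed
  qed
  moreover have "\<exists>N\<ge>n0. \<forall>n\<ge>N. G N \<le> lam n" for n0
    using s_ge[of n0] ge[of n0] G_le[of "s n0"] by (meson order_trans)
  ultimately show ?thesis using pos mono by blast
qed

subsection \<open>Coefficients of a distribution vanishing on an open set\<close>

text \<open>In the expansion of \<open>S f = 0\<close> only the index \<open>m\<close> and indices
  beyond \<open>N\<close> survive; the m-th term is therefore minus the tail, which is estimated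
  termwise.\<close>

lemma fourier_coeff_bound:
  assumes S: "circle_distribution S" and f: "f \<in> smooth_circle" "S f = 0"
    and coeff: "circle_coeff (circle_deriv 0 f) m = 1"
      "\<And>n. \<bar>n\<bar> \<le> N \<Longrightarrow> n \<noteq> m \<Longrightarrow> circle_coeff (circle_deriv 0 f) n = 0"
    and tail: "\<delta> \<ge> 0" "\<And>n. \<bar>n\<bar> > N \<Longrightarrow> cmod (fourier_coeff S n) \<le> \<delta>"
  shows "cmod (fourier_coeff S (- m)) \<le> \<delta> * (\<Sum>\<^sub>\<infinity>n. cmod (circle_coeff (circle_deriv 0 f) n))"
proof -
  let ?c = "circle_coeff (circle_deriv 0 f)"
  let ?s = "fourier_coeff S (- m)"
  \<comment> \<open>A series concentrated at \<open>m\<close>, subtracted below to isolate the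
    tail.\<close>
  have "((\<lambda>n. if n = m then ?s else 0) has_sum ?s) UNIV"
    by (rule has_sum_finite_neutralI[of "{m}"]) auto
  then have "((\<lambda>n. - (if n = m then ?s else 0)) has_sum - ?s) UNIV"
    by (simp only: has_sum_uminus minus_minus)
  from has_sum_add[OF circle_distribution_has_sum[OF S f(1)] this]
  have "((\<lambda>n. ?c n * fourier_coeff S (- n) - (if n = m then ?s else 0)) has_sum - ?s) UNIV"
    using f(2) by (simp del: circle_deriv_0)
  moreover have "((\<lambda>n. \<delta> * cmod (?c n)) has_sum \<delta> * (\<Sum>\<^sub>\<infinity>n. cmod (?c n))) UNIV"
    by (intro has_sum_cmult_right has_sum_infsum circle_coeff_abs_summable f)
  ultimately have "cmod (- ?s) \<le> \<delta> * (\<Sum>\<^sub>\<infinity>n. cmod (?c n))"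
  proof (rule norm_infsum_le)
    fix n
    show "cmod (?c n * fourier_coeff S (- n) - (if n = m then ?s else 0)) \<le> \<delta> * cmod (?c n)"
    proof (cases "n = m")
      case True
      then show ?thesis using coeff(1) tail(1) by (simp del: circle_deriv_0)
    next
      case False
      show ?thesis
      proof (cases "\<bar>n\<bar> \<le> N")
        case True
        then show ?thesis using coeff(2) False by simp
      next
        case n: False
        then have "cmod (fourier_coeff S (- n)) \<le> \<delta>" using tail(2)[of "- n"] by simp
        then show ?thesis using False by (simp add: norm_mult mult.commute mult_right_mono)
      qed
    qed
  qed
  then show ?thesis by simp
qed

text \<open>Only finitely many pairs \<open>j\<close>, \<open>m\<close> occur for a given
  \<open>N\<close>, so one test function is chosen for each and their norms are added up.\<close>

lemma exists_test_function_bound: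
  fixes V :: "nat \<Rightarrow> complex set"
  assumes "\<And>j. open (V j)"
  shows "\<exists>K\<ge>1. \<forall>j\<le>N. \<forall>m. \<bar>m\<bar> \<le> int N \<longrightarrow> V j \<inter> unit_circle \<noteq> {} \<longrightarrow>
    (\<exists>f. is_test_function (V j) (int N) m f \<and>
      (\<Sum>\<^sub>\<infinity>n. cmod (circle_coeff (circle_deriv 0 f) n)) \<le> K)"
proof -
  have "\<exists>f. V j \<inter> unit_circle \<noteq> {} \<longrightarrow> is_test_function (V j) (int N) m f" for j m
    using exists_test_function[OF assms] by blast
  then obtain F where
    F: "\<And>j m. V j \<inter> unit_circle \<noteq> {} \<Longrightarrow> is_test_function (V j) (int N) m (F j m)"
    by metis
  define w where "w = (\<lambda>(j, m). \<Sum>\<^sub>\<infinity>n. cmod (circle_coeff (circle_deriv 0 (F j m)) n))"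
  \<comment> \<open>The summand 1 keeps \<open>K\<close> positive, so that it can be divided by
    later.\<close>
  define K where "K = 1 + sum w ({..N} \<times> {- int N..int N})"
  have w: "w p \<ge> 0" for p by (auto simp: w_def split: prod.split intro: infsum_nonneg)
  have w_le: "w (j, m) \<le> K" if "j \<le> N" "\<bar>m\<bar> \<le> int N" for j m
  proof -
    have "w (j, m) \<le> sum w ({..N} \<times> {- int N..int N})"
      by (rule member_le_sum) (use that w in auto)
    then show ?thesis by (simp add: K_def)
  qed
  show ?thesis
  proof (intro exI[of _ K] conjI allI impI)
    show "1 \<le> K" using w by (simp add: K_def sum_nonneg)
    fix j m assume "j \<le> N" "\<bar>m\<bar> \<le> int N" "V j \<inter> unit_circle \<noteq> {}"
    then show "\<exists>f. is_test_function (V j) (int N) m f \<and>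
      (\<Sum>\<^sub>\<infinity>n. cmod (circle_coeff (circle_deriv 0 f) n)) \<le> K"
      using F w_le[of j m] by (intro exI[of _ "F j m"]) (auto simp: w_def)
  qed
qed

section \<open>Choice of the weight and vanishing of all Fourier coefficients\<close>

theorem theorem1p4:
  "\<exists>lam :: nat \<Rightarrow> real.
     (\<forall>n. lam n > 0) \<and> strict_mono lam \<and> filterlim lam at_top sequentially \<and>
     filterlim (\<lambda>N. \<Sum>n<N. 1 / lam n) at_top sequentially \<and>
     (\<forall>S. circle_distribution S \<longrightarrow> (\<exists>f\<in>smooth_circle. S f \<noteq> 0) \<longrightarrow>
        (\<lambda>n::int. (cmod (fourier_coeff S n))\<^sup>2 * lam (nat \<bar>n\<bar>)) summable_on UNIV \<longrightarrow>
        dist_support S = unit_circle)"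
proof -
  \<comment> \<open>Enumerating a countable basis of the plane lets the weight be fixed before
    \<open>S\<close>: an open set on which \<open>S\<close> vanishes contains the trace of some
    \<open>V j\<close>, and \<open>V j\<close> is taken into account from \<open>N = j\<close>
    on.\<close>
  obtain B :: "complex set set" where B: "countable B" "topological_basis B"
    using ex_countable_basis by blast
  define V where "V = from_nat_into B"
  have "B \<noteq> {}"
    using topological_basisE[OF B(2) open_UNIV UNIV_I] by blast
  then have range_V: "range V = B"
    using B(1) by (simp add: V_def range_from_nat_into)
  have open_V: "open (V j)" for j
    using range_V topological_basis_open[OF B(2)] by blast
  have "\<exists>K. \<forall>N. K N \<ge> 1 \<and> (\<forall>j\<le>N. \<forall>m. \<bar>m\<bar> \<le> int N \<longrightarrow> V j \<inter> unit_circle \<noteq> {} \<longrightarrow>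
    (\<exists>f. is_test_function (V j) (int N) m f \<and>
      (\<Sum>\<^sub>\<infinity>n. cmod (circle_coeff (circle_deriv 0 f) n)) \<le> K N))"
    by (rule choice, rule allI, rule exists_test_function_bound[OF open_V])
  then obtain K where K_ge: "\<And>N. K N \<ge> 1"
    and K: "\<And>N j m. j \<le> N \<Longrightarrow> \<bar>m\<bar> \<le> int N \<Longrightarrow> V j \<inter> unit_circle \<noteq> {} \<Longrightarrow>
      \<exists>f. is_test_function (V j) (int N) m f \<and>
        (\<Sum>\<^sub>\<infinity>n. cmod (circle_coeff (circle_deriv 0 f) n)) \<le> K N"
    by blast
  \<comment> \<open>The threshold is squared because the weight multiplies squared coefficients. Its
    factor \<open>real N\<close> supplies the decay in \<open>N\<close> that makes a fixed
    coefficient vanish.\<close>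
  obtain lam :: "nat \<Rightarrow> real" where lam: "\<forall>n. lam n > 0" "strict_mono lam"
    "filterlim lam at_top sequentially" "filterlim (\<lambda>N. \<Sum>n<N. 1 / lam n) at_top sequentially"
    and jump: "\<And>n0. \<exists>N\<ge>n0. \<forall>n\<ge>N. (real N * K N)\<^sup>2 \<le> lam n"
    using exists_slow_weight_with_jumps[of "\<lambda>N. (real N * K N)\<^sup>2"] by blast
  have "dist_support S = unit_circle"
    if S: "circle_distribution S" and nonzero: "\<exists>f\<in>smooth_circle. S f \<noteq> 0"
      and summable: "(\<lambda>n::int. (cmod (fourier_coeff S n))\<^sup>2 * lam (nat \<bar>n\<bar>)) summable_on UNIV" for S
  proof (rule ccontr)
    assume "dist_support S \<noteq> unit_circle"
    then obtain U x where U: "openin (top_of_set unit_circle) U" "vanishes_on S U" "x \<in> U" "x \<in> unit_circle"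
      unfolding dist_support_def by blast
    then obtain W where W: "open W" "U = unit_circle \<inter> W" by (auto simp: openin_open)
    with U obtain V' where "V' \<in> B" "x \<in> V'" "V' \<subseteq> W"
      using topological_basisE[OF B(2) W(1)] by blast
    with range_V obtain j where j: "x \<in> V j" "V j \<subseteq> W" by blast
    then have V_j: "V j \<inter> unit_circle \<noteq> {}" using U by blast
    define A where "A = (\<Sum>\<^sub>\<infinity>n::int. (cmod (fourier_coeff S n))\<^sup>2 * lam (nat \<bar>n\<bar>))"
    have A: "(cmod (fourier_coeff S n))\<^sup>2 * lam (nat \<bar>n\<bar>) \<le> A" for n
      using finite_sum_le_infsum[OF summable, of "{n}"] lam(1) by (auto simp: A_def less_imp_le)
    have "A \<ge> 0"
      using A[of 0] lam(1) by (meson order_trans zero_le_mult_iff zero_le_power2 less_imp_le)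
    have bound: "real N * cmod (fourier_coeff S (- m)) \<le> sqrt A"
      if N: "j \<le> N" "\<bar>m\<bar> \<le> int N" "0 < N" "\<forall>n\<ge>N. (real N * K N)\<^sup>2 \<le> lam n" for m N
    proof -
      have NK: "real N * K N > 0" using N(3) K_ge[of N] by (intro mult_pos_pos) auto
      obtain f where f: "f \<in> smooth_circle" "closure {z \<in> unit_circle. f z \<noteq> 0} \<subseteq> V j"
        "circle_coeff (circle_deriv 0 f) m = 1"
        "\<And>n. \<bar>n\<bar> \<le> int N \<Longrightarrow> n \<noteq> m \<Longrightarrow> circle_coeff (circle_deriv 0 f) n = 0"
        "(\<Sum>\<^sub>\<infinity>n. cmod (circle_coeff (circle_deriv 0 f) n)) \<le> K N"
        using K[OF N(1,2) V_j] unfolding is_test_function_def by blast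
      have "closure {z \<in> unit_circle. f z \<noteq> 0} \<subseteq> unit_circle"
        by (rule closure_minimal) auto
      then have "S f = 0"
        using U(2) f(1,2) j(2) unfolding vanishes_on_def W(2) by blast
      \<comment> \<open>The bound on the coefficients beyond \<open>N\<close>: each single term of
        the weighted sum is at most \<open>A\<close>, and the weight there is at least
        \<open>(real N * K N)\<^sup>2\<close>.\<close>
      define \<delta> where "\<delta> = sqrt A / (real N * K N)"
      have \<delta>: "\<delta> \<ge> 0" using NK \<open>A \<ge> 0\<close> by (simp add: \<delta>_def)
      have "cmod (fourier_coeff S n) \<le> \<delta>" if "\<bar>n\<bar> > int N" for n
      proof -
        have "(real N * K N)\<^sup>2 \<le> lam (nat \<bar>n\<bar>)" using N(4) that by simp
        then have "(cmod (fourier_coeff S n))\<^sup>2 * (real N * K N)\<^sup>2 \<le> A"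
          using A[of n] by (meson mult_left_mono order_trans zero_le_power2)
        then have "cmod (fourier_coeff S n) * (real N * K N) \<le> sqrt A"
          by (intro real_le_rsqrt) (simp add: power_mult_distrib)
        then show ?thesis using NK by (simp add: \<delta>_def pos_le_divide_eq)
      qed
      from fourier_coeff_bound[OF S f(1) \<open>S f = 0\<close> f(3,4) \<delta> this]
      have "cmod (fourier_coeff S (- m)) \<le> \<delta> * (\<Sum>\<^sub>\<infinity>n. cmod (circle_coeff (circle_deriv 0 f) n))"
        by blast
      also have "\<dots> \<le> \<delta> * K N" using f(5) \<delta> by (rule mult_left_mono)
      also have "\<dots> = sqrt A / real N" using K_ge[of N] by (simp add: \<delta>_def)
      finally show ?thesis using N(3) by (simp add: field_simps)
    qed
    have zero: "fourier_coeff S (- m) = 0" for m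
    proof (rule ccontr)
      assume "fourier_coeff S (- m) \<noteq> 0"
      then have pos: "cmod (fourier_coeff S (- m)) > 0" by simp
      then obtain n1 :: nat where n1: "sqrt A < real n1 * cmod (fourier_coeff S (- m))"
        using reals_Archimedean3 by blast
      \<comment> \<open>A jump late enough to cover the arc \<open>j\<close> and the index
        \<open>m\<close>, and past \<open>n1\<close>, where \<open>bound\<close> is already
        violated.\<close>
      obtain N where N: "N \<ge> max (max j (nat \<bar>m\<bar>)) (max 1 n1)" "\<forall>n\<ge>N. (real N * K N)\<^sup>2 \<le> lam n"
        using jump by blast
      have "real n1 * cmod (fourier_coeff S (- m)) \<le> real N * cmod (fourier_coeff S (- m))"
        using N(1) by (intro mult_right_mono) auto
      moreover have "real N * cmod (fourier_coeff S (- m)) \<le> sqrt A"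
        by (rule bound) (use N in auto)
      ultimately show False using n1 by linarith
    qed
    \<comment> \<open>All terms of the expansion of \<open>S f\<close> are 0, contrary to
      \<open>S\<close> being nonzero.\<close>
    have "S f = 0" if "f \<in> smooth_circle" for f
    proof (rule has_sum_unique)
      show "((\<lambda>n::int. 0) has_sum S f) UNIV"
        using circle_distribution_has_sum[OF S that] by (simp add: zero)
    qed (simp add: has_sum_0)
    with nonzero show False by blast
  qed
  with lam show ?thesis by blast
qed

end
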